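(* Let $\mathcal T$ be the $k$-ary tree of the global strategy $A^*$, let $\mathbb P\subseteq A^*$ be a paid strategy matrix, let $\mathcal C\subseteq A^*$ be any set of cached queries, and let $\Delta\mathbb P$ be the output of the proactive querying algorithm on input $\mathbb P$. Then $$\|\mathbb P\cup\Delta\mathbb P\|_1=\|\mathbb P\|_1 .$$
   Context: **Setting.** $\mathcal T$ is a rooted tree over a finite ordered domain of size $n$ ($k$-ary, $k\ge2$): each node $v$ corresponds to a range of domain values, the root to the full domain, the leaves to single values, and the ranges of the children of each non-leaf node are non-overlapping and partition the node's range. $v.\mathrm{query}\in\{0,1\}^n$ is the indicator vector of the range of $v$, and the global strategy $A^*$ is the matrix whose rows are all these vectors. A matrix $\mathbb P\subseteq A^*$ is a matrix whose rows are a subset of the rows of $A^*$, and $\mathbb P$ is also viewed as this set. $\|M\|_1$ is the maximum over columns of the sum of absolute values. **Subtree norm.** $\mathcal M_{\mathbb P}(v)=1$ if $v.\mathrm{query}\in\mathbb P$ ("$v$ is marked"), else $0$. $\mathcal S_{\mathbb P}(v)=\max_{p}\sum_{u\in p}\mathcal M_{\mathbb P}(u)$, the maximum being over all directed paths $p$ from $v$ down to a leaf. **Proactive querying algorithm.** Start with $\Delta\mathbb P=\emptyset$ and call Search(root, $r$) with $r=\|\mathbb P\|_1$, where Search($v$, $r$) is the recursive procedure: 1. if $v.\mathrm{query}\in\mathbb P$, set $r\leftarrow r-1$; else, if $v.\mathrm{query}\notin\mathcal C$ and $\mathcal S_{\mathbb P}(v)<r$, add $v.\mathrm{query}$ to $\Delta\mathbb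 P$ and set $r\leftarrow r-1$; 2. if $r>0$ and $v$ has children, call Search($c$, $r$) for each child $c$ of $v$ (each call receives its own copy of $r$). The output is the final $\Delta\mathbb P$. *)

theory Defs
  imports "Jordan_Normal_Form.Matrix" "HOL-Library.Disjoint_Sets"
begin

text \<open>
  The ordered domain of size \<open>n\<close> is \<open>{0..<n}\<close>.  A node is identified with the subtree
  it roots.
\<close>

datatype range_tree = Node (node_range: "nat set") (children: "range_tree list")

text \<open>
  A non-leaf node has between one and \<open>k\<close> children, so trees in which every non-leaf node
  has exactly \<open>k\<close> children (possible only for some \<open>n\<close>) are included.  \<^const>\<open>partition_on\<close>
  forces the children's ranges to be nonempty, pairwise disjoint as sets and to cover \<open>R\<close>;
  \<^const>\<open>distinct\<close> additionally excludes two children with the same range.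
\<close>

fun kary_tree :: "nat \<Rightarrow> range_tree \<Rightarrow> bool" where
  "kary_tree k (Node R ts) \<longleftrightarrow>
     (\<exists>a b. a \<le> b \<and> R = {a..b}) \<and>
     (if ts = [] then is_singleton R
      else length ts \<le> k \<and> distinct (map node_range ts) \<and>
           partition_on R (node_range ` set ts)) \<and>
     (\<forall>t\<in>set ts. kary_tree k t)"

fun nodes :: "range_tree \<Rightarrow> range_tree set" where
  "nodes (Node R ts) = insert (Node R ts) (\<Union>t\<in>set ts. nodes t)"

definition query :: "nat \<Rightarrow> range_tree \<Rightarrow> int vec" where
  "query n v = vec n (\<lambda>i. if i \<in> node_range v then 1 else 0)"

text \<open>Strategy matrices are represented by their sets of rows.\<close>

definition global_strategy :: "nat \<Rightarrow> range_tree \<Rightarrow> int vec set" where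
  "global_strategy n T = query n ` nodes T"

definition norm1 :: "nat \<Rightarrow> int vec set \<Rightarrow> int" where
  "norm1 n M = Max ((\<lambda>j. \<Sum>q\<in>M. \<bar>q $ j\<bar>) ` {0..<n})"

definition marked :: "nat \<Rightarrow> int vec set \<Rightarrow> range_tree \<Rightarrow> int" where
  "marked n P v = (if query n v \<in> P then 1 else 0)"

fun leaf_paths :: "range_tree \<Rightarrow> range_tree list set" where
  "leaf_paths (Node R ts) =
     (if ts = [] then {[Node R ts]}
      else (\<lambda>p. Node R ts # p) ` (\<Union>t\<in>set ts. leaf_paths t))"

definition subtree_norm :: "nat \<Rightarrow> int vec set \<Rightarrow> range_tree \<Rightarrow> int" where
  "subtree_norm n P v = Max ((\<lambda>p. \<Sum>u\<leftarrow>p. marked n P u) ` leaf_paths v)"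

text \<open>
  The last argument \<open>D\<close> is the current value of the global variable \<open>\<Delta>P\<close>; it is threaded
  through the calls for the children, and its value after the call is returned.
\<close>

fun search ::
  "nat \<Rightarrow> int vec set \<Rightarrow> int vec set \<Rightarrow> range_tree \<Rightarrow> int \<Rightarrow> int vec set \<Rightarrow> int vec set"
where
  "search n P C (Node R ts) r D =
     (let v = Node R ts;
          (r', D') =
            (if query n v \<in> P then (r - 1, D)
             else if query n v \<notin> C \<and> subtree_norm n P v < r
             then (r - 1, insert (query n v) D)
             else (r, D))
      in if r' > 0 then fold (\<lambda>c. search n P C c r') ts D' else D')"

definition proactive_queries ::
  "nat \<Rightarrow> range_tree \<Rightarrow> int vec set \<Rightarrow> int vec set \<Rightarrow> int vec set" where
  "proactive_queries n T P C = search n P C T (norm1 n P) {}"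

end

(* A call of Search at v with budget r guarantees, for every column j in the range of v, that the
   number of paid or added queries of the subtree of v with a 1 in column j is at most the larger
   of r and the number of paid ones.  A query is added at v only when the subtree norm, which
   dominates the number of paid queries, is below r, so the addition stays within the budget.
   At the root both bounds are at most the norm of P. *)

theory Submission
  imports Defs
begin

section \<open>Columns of a set of queries and the ranges of the tree\<close>

text \<open>For a finite set of queries and \<open>j < n\<close>, the cardinality of this set is the
  column sum in \<open>norm1\<close>. Counting sets instead of adding along nodes merges equal
  queries of different nodes by itself.\<close>

definition column_support :: "nat \<Rightarrow> int vec set \<Rightarrow> int vec set" where
  "column_support j M = {q \<in> M. q $ j \<noteq> 0}"

lemma column_support_Un:
  "column_support j (A \<union> B) = column_support j A \<union> column_support j B"
  by (auto simp: column_support_def)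

lemma column_support_subset: "column_support j M \<subseteq> M"
  by (auto simp: column_support_def)

lemma column_support_mono: "A \<subseteq> B \<Longrightarrow> column_support j A \<subseteq> column_support j B"
  by (auto simp: column_support_def)

lemma finite_nodes: "finite (nodes v)"
  by (induction v) auto

lemma node_range_nodes_subset:
  "kary_tree k v \<Longrightarrow> u \<in> nodes v \<Longrightarrow> node_range u \<subseteq> node_range v"
proof (induction v)
  case (Node R ts)
  have "node_range c \<subseteq> R" if "c \<in> set ts" for c
    using Node.prems(1) that by (auto simp: partition_on_def split: if_splits)
  with Node show ?case
    by fastforce
qed

lemma child_containing:
  assumes "kary_tree k (Node R ts)" "j \<in> R" "ts \<noteq> []"
  obtains c where "c \<in> set ts" "j \<in> node_range c"
proof -
  from assms have "j \<in> \<Union> (node_range ` set ts)"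
    by (auto simp: partition_on_def)
  then show ?thesis
    using that by blast
qed

lemma other_child_not_containing:
  assumes "kary_tree k (Node R ts)" "c \<in> set ts" "d \<in> set ts" "c \<noteq> d" "j \<in> node_range c"
  shows "j \<notin> node_range d"
proof -
  from assms(1,2) have "distinct (map node_range ts)" "disjoint (node_range ` set ts)"
    by (auto simp: partition_on_def split: if_splits)
  \<comment> \<open>Disjointness of the set of ranges says nothing about two children with the same
    range; distinctness of the list rules that case out.\<close>
  moreover from this(1) assms(2-4) have "node_range c \<noteq> node_range d"
    by (auto simp: distinct_map inj_on_def)
  ultimately show ?thesis
    using assms(2,3,5) by (auto simp: disjoint_def)
qed

text \<open>Ranges shrink downwards and siblings have disjoint ranges, so below any child other than
  \<open>c\<close> every query is 0 in column \<open>j\<close>. The family \<open>X\<close> stays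
  general because it stands for the paid queries alone and later for the paid and added ones
  together.\<close>

lemma column_support_children:
  assumes "kary_tree k (Node R ts)" "c \<in> set ts" "j \<in> node_range c" "j < n"
    and sub: "\<And>d. d \<in> set ts \<Longrightarrow> X d \<subseteq> query n ` nodes d"
  shows "column_support j (\<Union>d\<in>set ts. X d) = column_support j (X c)"
proof -
  have "column_support j (X d) = {}" if d: "d \<in> set ts" "d \<noteq> c" for d
  proof -
    have "j \<notin> node_range d"
      using other_child_not_containing assms(1-3) d by metis
    moreover have "kary_tree k d"
      using assms(1) d(1) by simp
    ultimately have "j \<notin> node_range u" if "u \<in> nodes d" for u
      using node_range_nodes_subset that by blast
    then show ?thesis
      using sub[OF d(1)] \<open>j < n\<close> by (auto simp: column_support_def query_def)
  qed
  then show ?thesis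
    using assms(2) by (fastforce simp: column_support_def)
qed

section \<open>The subtree norm as a bound on the paid queries\<close>

lemma finite_leaf_paths: "finite (leaf_paths v)"
  by (induction v) auto

lemma leaf_paths_nonempty: "leaf_paths v \<noteq> {}"
  by (induction v) (auto simp: neq_Nil_conv)

lemma subtree_norm_attained:
  obtains p where "p \<in> leaf_paths v" "subtree_norm n P v = (\<Sum>u\<leftarrow>p. marked n P u)"
proof -
  have "subtree_norm n P v \<in> (\<lambda>p. \<Sum>u\<leftarrow>p. marked n P u) ` leaf_paths v"
    unfolding subtree_norm_def using finite_leaf_paths leaf_paths_nonempty by (intro Max_in) auto
  then show ?thesis
    using that by blast
qed

lemma subtree_norm_ge:
  "p \<in> leaf_paths v \<Longrightarrow> (\<Sum>u\<leftarrow>p. marked n P u) \<le> subtree_norm n P v"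
  unfolding subtree_norm_def using finite_leaf_paths by (intro Max_ge) auto

text \<open>Prepending the parent to a heaviest path of the child yields a path of the
  parent.\<close>

lemma subtree_norm_child:
  assumes "c \<in> set ts"
  shows "marked n P (Node R ts) + subtree_norm n P c \<le> subtree_norm n P (Node R ts)"
proof -
  obtain p where p: "p \<in> leaf_paths c" "subtree_norm n P c = (\<Sum>u\<leftarrow>p. marked n P u)"
    by (rule subtree_norm_attained)
  have "Node R ts # p \<in> leaf_paths (Node R ts)"
    using assms p(1) by auto
  from subtree_norm_ge[OF this, of n P] p(2) show ?thesis
    by simp
qed

text \<open>The nodes whose range contains \<open>j\<close> form one path from \<open>v\<close> to a
  leaf, and every query counted on the left marks a node of that path. Equality may fail: another
  path may be heavier, and a query shared by several nodes of the path is counted once on the left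
  but repeatedly on the right.\<close>

lemma card_column_support_le_subtree_norm:
  "kary_tree k v \<Longrightarrow> j \<in> node_range v \<Longrightarrow> j < n \<Longrightarrow>
    int (card (column_support j (P \<inter> query n ` nodes v))) \<le> subtree_norm n P v"
proof (induction v)
  case (Node R ts)
  let ?v = "Node R ts"
  let ?X = "\<lambda>d. P \<inter> query n ` nodes d"
  have split: "?X ?v = (P \<inter> {query n ?v}) \<union> (\<Union>d\<in>set ts. ?X d)"
    by auto
  have own: "int (card (column_support j (P \<inter> {query n ?v}))) \<le> marked n P ?v"
  proof (cases "query n ?v \<in> P")
    case True
    have "card (column_support j (P \<inter> {query n ?v})) \<le> card {query n ?v}"
      by (intro card_mono) (auto simp: column_support_def)
    with True show ?thesis
      by (simp add: marked_def)
  qed (simp add: column_support_def marked_def)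
  show ?case
  proof (cases "ts = []")
    case True
    have "marked n P ?v \<le> subtree_norm n P ?v"
      using subtree_norm_ge[of "[?v]" ?v n P] True by simp
    with own split True show ?thesis
      by simp
  next
    case False
    with Node.prems obtain c where c: "c \<in> set ts" "j \<in> node_range c"
      using child_containing[of k R ts j] by auto
    have children: "column_support j (\<Union>d\<in>set ts. ?X d) = column_support j (?X c)"
      by (rule column_support_children[OF Node.prems(1) c Node.prems(3)]) auto
    have "card (column_support j (?X ?v))
        \<le> card (column_support j (P \<inter> {query n ?v})) + card (column_support j (?X c))"
      unfolding split column_support_Un children by (rule card_Un_le)
    moreover have "int (card (column_support j (?X c))) \<le> subtree_norm n P c"
      using Node.IH[OF c(1)] Node.prems c by simp
    ultimately show ?thesis
      using own subtree_norm_child[OF c(1), of n P R] by linarith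
  qed
qed

section \<open>The search procedure\<close>

lemma fold_accumulate:
  assumes "\<And>c D. c \<in> set cs \<Longrightarrow> f c D = D \<union> f c {}"
  shows "fold f cs D = D \<union> (\<Union>c\<in>set cs. f c {})"
  using assms
proof (induction cs arbitrary: D)
  case (Cons c cs)
  have "fold f cs (f c D) = f c D \<union> (\<Union>d\<in>set cs. f d {})"
    by (rule Cons.IH, rule Cons.prems) simp
  moreover have "f c D = D \<union> f c {}"
    by (rule Cons.prems) simp
  ultimately show ?case
    by (simp add: Un_assoc)
qed simp

declare search.simps [simp del]

text \<open>The accumulator is only extended and never read: all tests depend on \<open>P\<close>,
  \<open>C\<close>, the node and the budget. Hence the calls for siblings are independent and the
  fold over them is a union.\<close>

lemma search_accumulate: "search n P C v r D = D \<union> search n P C v r {}"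
proof (induction v arbitrary: r D)
  case (Node R ts)
  have "fold (\<lambda>c. search n P C c s) ts E = E \<union> (\<Union>c\<in>set ts. search n P C c s {})" for s E
    using Node.IH by (intro fold_accumulate)
  then show ?case
    by (auto simp: search.simps Let_def)
qed

lemma fold_search:
  "fold (\<lambda>c. search n P C c r) ts D = D \<union> (\<Union>c\<in>set ts. search n P C c r {})"
  using search_accumulate by (intro fold_accumulate)

lemma search_subset: "search n P C v r {} \<subseteq> query n ` nodes v"
proof (induction v arbitrary: r)
  case (Node R ts)
  then show ?case
    by (auto simp: search.simps Let_def fold_search split: if_splits) blast+
qed

text \<open>The maximum lets the induction run for every budget. The budget can fall below the
  number of paid queries, since a paid query shared by a node and its only child may be charged
  twice but is counted once.\<close>

lemma card_column_support_search:
  "kary_tree k v \<Longrightarrow> j \<in> node_range v \<Longrightarrow> j < n \<Longrightarrow>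
    int (card (column_support j ((P \<inter> query n ` nodes v) \<union> search n P C v r {})))
      \<le> max r (int (card (column_support j (P \<inter> query n ` nodes v))))"
proof (induction v arbitrary: r)
  case (Node R ts)
  let ?v = "Node R ts"
  let ?q = "query n ?v"
  let ?X = "\<lambda>d. P \<inter> query n ` nodes d"
  let ?N = "\<lambda>d. card (column_support j (?X d))"
  \<comment> \<open>One call is split into the decision at this node, the budget passed down, and
    the contributions of the node and of its children.\<close>
  define add where "add \<longleftrightarrow> ?q \<notin> P \<and> ?q \<notin> C \<and> subtree_norm n P ?v < r"
  define s where "s = (if ?q \<in> P \<or> add then r - 1 else r)"
  define own where "own = (if add then {?q} else {})"
  define below where "below = (if s > 0 then \<Union>d\<in>set ts. search n P C d s {} else {})"
  have search_eq: "search n P C ?v r {} = own \<union> below"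
    by (auto simp: own_def below_def s_def add_def search.simps Let_def fold_search)
  have finX: "finite (column_support j (?X d))" for d
    by (rule finite_subset[OF column_support_subset]) (simp add: finite_nodes)
  have norm: "int (?N ?v) \<le> subtree_norm n P ?v"
    using card_column_support_le_subtree_norm[OF Node.prems] .
  have own_card: "card own = (if add then 1 else 0)"
    by (simp add: own_def)
  show ?case
  proof (cases "s > 0 \<and> ts \<noteq> []")
    case False
    then have "below = {}"
      by (auto simp: below_def)
    then have sub:
      "column_support j (?X ?v \<union> search n P C ?v r {}) \<subseteq> column_support j (?X ?v) \<union> own"
      by (auto simp: search_eq column_support_def)
    have "finite (column_support j (?X ?v) \<union> own)"
      using finX[of ?v] by (simp add: own_def)
    from card_mono[OF this sub]
    have "card (column_support j (?X ?v \<union> search n P C ?v r {}))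
        \<le> card (column_support j (?X ?v) \<union> own)" .
    also have "\<dots> \<le> ?N ?v + card own"
      by (rule card_Un_le)
    \<comment> \<open>At most one query is new, and then the paid count is below \<open>r\<close>,
      so adding one keeps it at most \<open>r\<close>.\<close>
    finally show ?thesis
      using norm own_card by (auto simp: add_def split: if_splits)
  next
    case True
    with Node.prems obtain c where c: "c \<in> set ts" "j \<in> node_range c"
      using child_containing[of k R ts j] by auto
    let ?F = "column_support j (?X c \<union> search n P C c s {})"
    have finF: "finite ?F"
      using finX search_subset[of n P C c s] finite_nodes
      by (intro finite_subset[OF column_support_subset]) (auto intro: finite_subset)
    have IH: "int (card ?F) \<le> max s (int (?N c))"
      using Node.IH[OF c(1)] Node.prems c by simp
    have children: "column_support j (\<Union>d\<in>set ts. ?X d \<union> search n P C d s {}) = ?F"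
      by (rule column_support_children[OF Node.prems(1) c Node.prems(3)])
        (use search_subset in auto)
    \<comment> \<open>Paid and added queries are regrouped child by child, so that only the set
      \<open>?F\<close> of the induction hypothesis survives in column \<open>j\<close>.\<close>
    have "?X ?v \<union> search n P C ?v r {}
        = (P \<inter> {?q}) \<union> own \<union> (\<Union>d\<in>set ts. ?X d \<union> search n P C d s {})"
      using True by (auto simp: search_eq below_def)
    then have split: "column_support j (?X ?v \<union> search n P C ?v r {})
        = column_support j ((P \<inter> {?q}) \<union> own) \<union> ?F"
      by (simp only: column_support_Un[of j "(P \<inter> {?q}) \<union> own"] children)
    have Xc: "column_support j (?X c) \<subseteq> column_support j (?X ?v)"
      using c(1) by (intro column_support_mono) auto
    then have N_mono: "?N c \<le> ?N ?v"
      by (intro card_mono finX)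
    have "?q $ j \<noteq> 0"
      using Node.prems by (simp add: query_def)
    then have q_support: "?q \<in> column_support j A \<longleftrightarrow> ?q \<in> A" for A
      by (simp add: column_support_def)
    have top: "column_support j ((P \<inter> {?q}) \<union> own) = (if ?q \<in> P \<or> add then {?q} else {})"
      using \<open>?q $ j \<noteq> 0\<close> by (auto simp: column_support_def own_def)
    consider (marked) "?q \<in> P" | (add) add | (skip) "?q \<notin> P" "\<not> add"
      by blast
    then show ?thesis
    proof cases
      case marked
      then have "s = r - 1"
        by (simp add: s_def)
      from marked have insert: "column_support j (?X ?v \<union> search n P C ?v r {}) = insert ?q ?F"
        unfolding split top by simp
      show ?thesis
      proof (cases "?q \<in> ?X c")
        \<comment> \<open>possible, since an only child has the query of its parent\<close>
        case True
        then have "insert ?q ?F = ?F"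
          using q_support by auto
        then show ?thesis
          using insert IH N_mono \<open>s = r - 1\<close> by auto
      next
        case False
        \<comment> \<open>Passing to \<open>c\<close> lowers both terms of the maximum by at least
          one: the budget by the charge, the paid count because \<open>?q\<close> is not among the
          paid queries below \<open>c\<close>. This pays for counting \<open>?q\<close> on top of
          \<open>?F\<close>.\<close>
        then have "card (insert ?q (column_support j (?X c))) = Suc (?N c)"
          using q_support finX by simp
        moreover have "insert ?q (column_support j (?X c)) \<subseteq> column_support j (?X ?v)"
          using Xc marked q_support by auto
        ultimately have "Suc (?N c) \<le> ?N ?v"
          using card_mono finX by metis
        moreover have "card (insert ?q ?F) \<le> Suc (card ?F)"
          by (simp add: card_insert_if finF)
        ultimately show ?thesis
          using insert IH \<open>s = r - 1\<close> by auto
      qed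
    next
      case add
      then have "column_support j (?X ?v \<union> search n P C ?v r {}) = insert ?q ?F"
        unfolding split top by simp
      moreover have "card (insert ?q ?F) \<le> Suc (card ?F)"
        by (simp add: card_insert_if finF)
      \<comment> \<open>Here \<open>?N c\<close> \<le> \<open>?N ?v\<close> < \<open>r\<close>, so
        both terms of the induction hypothesis are at most \<open>r - 1\<close>, which leaves room
        for \<open>?q\<close>.\<close>
      moreover have "s = r - 1" "subtree_norm n P ?v < r"
        using add by (auto simp: s_def add_def)
      ultimately show ?thesis
        using IH N_mono norm by auto
    next
      case skip
      then have "column_support j (?X ?v \<union> search n P C ?v r {}) = ?F"
        unfolding split top by simp
      moreover have "s = r"
        using skip by (simp add: s_def)
      ultimately show ?thesis
        using IH N_mono by auto
    qed
  qed
qed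

section \<open>From cardinalities back to the norm\<close>

lemma sum_abs_column_eq_card:
  assumes "M \<subseteq> query n ` V" "finite M" "j < n"
  shows "(\<Sum>q\<in>M. \<bar>q $ j\<bar>) = int (card (column_support j M))"
proof -
  have "(\<Sum>q\<in>M. \<bar>q $ j\<bar>) = (\<Sum>q\<in>M. if q $ j \<noteq> 0 then 1 else 0)"
    using assms by (intro sum.cong) (fastforce simp: query_def split: if_splits)+
  also have "\<dots> = int (card (column_support j M))"
    using assms(2) by (simp add: column_support_def sum.If_cases Int_def conj_commute)
  finally show ?thesis .
qed

theorem theorem5p2:
  fixes k n :: nat and T :: range_tree and P C :: "int vec set"
  assumes "k \<ge> 2"
    and "kary_tree k T" and "node_range T = {0..<n}"
    and "P \<subseteq> global_strategy n T"
    and "C \<subseteq> global_strategy n T"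
  shows "norm1 n (P \<union> proactive_queries n T P C) = norm1 n P"
proof -
  let ?Q = "P \<union> proactive_queries n T P C"
  have Q: "?Q \<subseteq> query n ` nodes T"
    using assms(4) search_subset by (auto simp: global_strategy_def proactive_queries_def)
  then have finQ: "finite ?Q"
    using finite_nodes finite_subset by blast
  \<comment> \<open>The range of the root is a nonempty interval, so there is at least one column
    and the maximum in \<open>norm1\<close> is taken over a nonempty set.\<close>
  have "node_range T \<noteq> {}"
    using assms(2) by (cases T) auto
  then have "n > 0"
    using assms(3) by auto
  have P: "P \<inter> query n ` nodes T = P"
    using assms(4) by (auto simp: global_strategy_def)
  have sum_P: "(\<Sum>q\<in>P. \<bar>q $ j\<bar>) \<le> norm1 n P" if "j < n" for j
    unfolding norm1_def using that by (intro Max_ge) auto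
  have "(\<Sum>q\<in>?Q. \<bar>q $ j\<bar>) \<le> norm1 n P" if j: "j < n" for j
  proof -
    have "int (card (column_support j ?Q)) \<le> max (norm1 n P) (int (card (column_support j P)))"
      using card_column_support_search[OF assms(2), of j n P C "norm1 n P"] assms(3) j
      by (simp add: P proactive_queries_def)
    moreover have "int (card (column_support j P)) = (\<Sum>q\<in>P. \<bar>q $ j\<bar>)"
      using sum_abs_column_eq_card[of P n "nodes T" j] Q finQ j by simp
    ultimately show ?thesis
      using sum_abs_column_eq_card[OF Q finQ j] sum_P[OF j] by simp
  qed
  then have "norm1 n ?Q \<le> norm1 n P"
    unfolding norm1_def[of n ?Q] using \<open>n > 0\<close> by (intro Max.boundedI) auto
  moreover have "norm1 n P \<le> norm1 n ?Q"
  proof -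
    have "(\<Sum>q\<in>P. \<bar>q $ j\<bar>) \<le> norm1 n ?Q" if "j < n" for j
    proof -
      have "(\<Sum>q\<in>P. \<bar>q $ j\<bar>) \<le> (\<Sum>q\<in>?Q. \<bar>q $ j\<bar>)"
        using finQ by (intro sum_mono2) auto
      also have "\<dots> \<le> norm1 n ?Q"
        unfolding norm1_def using that by (intro Max_ge) auto
      finally show ?thesis .
    qed
    then show ?thesis
      unfolding norm1_def[of n P] using \<open>n > 0\<close> by (intro Max.boundedI) auto
  qed
  ultimately show ?thesis
    by simp
qed

end
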